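(* Let $k$ be a number field with $k\subset\mathbb{R}$, and let $f(t)=a_{0}t^6+\sum_{i=0}^{4}a_{6-i}t^{i}\in k[t]$ with $a_0\neq 0$. Then for each $\epsilon>0$ there exists a polynomial $g(t)=c_{0}t^6+\sum_{i=0}^{4}c_{6-i}t^{i}\in k[t]$ such that $|a_i-c_i|<\epsilon$ for $i=0,2,3,4,5,6$ and such that for every pure cubic extension $K=k(\alpha)$ of $k$, with $\alpha^3+b=0$ for some $b\in k\setminus k^3$, the variety $\mathcal{S}_g\subset\mathbb{A}^4$ defined by \[ X_{1}^3-bX_{2}^3+b^2X_{3}^3+3bX_{1}X_{2}X_{3}=g(t) \] is $k$-unirational.
   Context: The left-hand side is the norm form $N_{K/k}(X_1+\alpha X_2+\alpha^2X_3)$. A variety over $k$ is $k$-unirational if there is a dominant rational map defined over $k$ from some affine space $\mathbb{A}^n_k$ to it. *)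

theory Defs
  imports
    Complex_Main
    "HOL-Library.FuncSet"
    "HOL-Library.Poly_Mapping"
    "HOL-Computational_Algebra.Polynomial"
    "HOL-Algebra.Generated_Fields"
    "HOL-Algebra.Algebraic_Closure_Type"
begin

definition real_number_field :: "real set \<Rightarrow> bool" where
  "real_number_field k \<longleftrightarrow>
     subfield k ring_of_type_algebra \<and> ring.finite_dimension ring_of_type_algebra \<rat> k"

(* Extensions of k are taken inside the complex numbers, which contain an algebraic closure of k.
   generate_field is the subfield k(alpha). *)
definition pure_cubic_extension :: "real set \<Rightarrow> complex set \<Rightarrow> complex \<Rightarrow> real \<Rightarrow> bool" where
  "pure_cubic_extension k K \<alpha> b \<longleftrightarrow>
     b \<in> k - (\<lambda>x. x ^ 3) ` k \<and> \<alpha> ^ 3 + of_real b = 0 \<and>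
     K = generate_field ring_of_type_algebra (of_real ` k \<union> {\<alpha>})"

(* A polynomial maps each monomial (the finitely supported exponent function) to its coefficient. *)
type_synonym mpoly = "(nat \<Rightarrow>\<^sub>0 nat) \<Rightarrow>\<^sub>0 complex"

definition mpolys :: "complex set \<Rightarrow> nat \<Rightarrow> mpoly set" where
  "mpolys F n = {p. (\<forall>m. Poly_Mapping.lookup p m \<in> F) \<and>
                    (\<forall>m \<in> Poly_Mapping.keys p. Poly_Mapping.keys m \<subseteq> {..<n})}"

definition mpoly_eval :: "mpoly \<Rightarrow> (nat \<Rightarrow> complex) \<Rightarrow> complex" where
  "mpoly_eval p x = (\<Sum>m \<in> Poly_Mapping.keys p. Poly_Mapping.lookup p m *
                       (\<Prod>i \<in> Poly_Mapping.keys m. x i ^ Poly_Mapping.lookup m i))"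

(* Varieties over k are represented by their sets of complex points; coordinates are numbered
   from 0. *)
definition affine_space :: "nat \<Rightarrow> (nat \<Rightarrow> complex) set" where
  "affine_space n = (\<Pi>\<^sub>E i \<in> {..<n}. UNIV)"

definition zariski_closure :: "nat \<Rightarrow> (nat \<Rightarrow> complex) set \<Rightarrow> (nat \<Rightarrow> complex) set" where
  "zariski_closure m A = {x \<in> affine_space m.
     \<forall>p \<in> mpolys UNIV m. (\<forall>y \<in> A. mpoly_eval p y = 0) \<longrightarrow> mpoly_eval p x = 0}"

(* The rational map from affine n-space to affine m-space with components p i / q i,
   evaluated on the dense open set where no denominator vanishes. *)
definition ratmap_image ::
    "nat \<Rightarrow> nat \<Rightarrow> (nat \<Rightarrow> mpoly) \<Rightarrow> (nat \<Rightarrow> mpoly) \<Rightarrow> (nat \<Rightarrow> complex) set" where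
  "ratmap_image n m p q =
     (\<lambda>x. \<lambda>i\<in>{..<m}. mpoly_eval (p i) x / mpoly_eval (q i) x) `
       {x \<in> affine_space n. \<forall>i<m. mpoly_eval (q i) x \<noteq> 0}"

(* Dominance, i.e. Zariski density of the image, does not depend on the chosen representative
   p / q of the rational map. *)
definition unirational :: "complex set \<Rightarrow> nat \<Rightarrow> (nat \<Rightarrow> complex) set \<Rightarrow> bool" where
  "unirational F m V \<longleftrightarrow>
     (\<exists>n p q. (\<forall>i<m. p i \<in> mpolys F n \<and> q i \<in> mpolys F n \<and> q i \<noteq> 0) \<and>
              ratmap_image n m p q \<subseteq> V \<and> V \<subseteq> zariski_closure m (ratmap_image n m p q))"

(* The coordinates X1, X2, X3, t are x 0, x 1, x 2, x 3. *)
definition norm_variety :: "real \<Rightarrow> real poly \<Rightarrow> (nat \<Rightarrow> complex) set" where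
  "norm_variety b g = {x \<in> affine_space 4.
     x 0 ^ 3 - of_real b * x 1 ^ 3 + of_real b ^ 2 * x 2 ^ 3 + 3 * of_real b * x 0 * x 1 * x 2
       = poly (map_poly of_real g) (x 3)}"

end

theory Submission
  imports Defs "HOL-Computational_Algebra.Fundamental_Theorem_Algebra"
begin

text \<open>Choose \<open>c0 = d\<^sup>3\<close> with \<open>d\<close> rational, and perturb \<open>a3\<close>, \<open>a5\<close> so that \<open>c3 \<noteq> 0\<close> and
  \<open>3 d\<^sup>3 c5 \<noteq> c2 c3\<close>. Substituting \<open>X1 = d t\<^sup>2 + p\<close>, \<open>X2 = v t + w\<close>, \<open>X3 = r\<close> into the equation
  cancels the terms in \<open>t\<^sup>6\<close> and \<open>t\<^sup>5\<close>; for given \<open>v\<close> one can choose \<open>p, w, r\<close> rationally so that those in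
  \<open>t\<^sup>4, t\<^sup>3, t\<^sup>2\<close> vanish as well. What remains is linear in \<open>t\<close>, so
  \<open>t\<close> becomes a rational function of \<open>v\<close>; it has a pole at \<open>v = 0\<close>, hence is not constant. This
  curve is a section of the fibration over the \<open>t\<close>-line after the base change \<open>v \<mapsto> t\<close>, and
  multiplying it by the norm one elements \<open>z\<^sup>3 / N(z)\<close> of \<open>K\<close> sweeps out the whole hypersurface.\<close>

subsection \<open>Polynomial functions\<close>

definition monom_eval :: "(nat \<Rightarrow>\<^sub>0 nat) \<Rightarrow> (nat \<Rightarrow> complex) \<Rightarrow> complex" where
  "monom_eval m x = (\<Prod>i\<in>Poly_Mapping.keys m. x i ^ Poly_Mapping.lookup m i)"

text \<open>Indices outside the support contribute \<open>x i ^ 0 = 1\<close>, so two monomials can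
  be compared over the union of their supports.\<close>

lemma monom_eval_superset:
  assumes "finite A" "Poly_Mapping.keys m \<subseteq> A"
  shows "monom_eval m x = (\<Prod>i\<in>A. x i ^ Poly_Mapping.lookup m i)"
  unfolding monom_eval_def
  using assms by (intro prod.mono_neutral_left) (auto simp: in_keys_iff)

lemma monom_eval_add: "monom_eval (m + m') x = monom_eval m x * monom_eval m' x"
proof -
  let ?A = "Poly_Mapping.keys m \<union> Poly_Mapping.keys m'"
  have "monom_eval (m + m') x = (\<Prod>i\<in>?A. x i ^ Poly_Mapping.lookup (m + m') i)"
    using Poly_Mapping.keys_add[of m m'] by (intro monom_eval_superset) auto
  also have "\<dots> = monom_eval m x * monom_eval m' x"
    by (simp add: lookup_add power_add prod.distrib monom_eval_superset[of ?A])
  finally show ?thesis .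
qed

lemma mpoly_eval_superset:
  assumes "finite A" "Poly_Mapping.keys p \<subseteq> A"
  shows "mpoly_eval p x = (\<Sum>m\<in>A. Poly_Mapping.lookup p m * monom_eval m x)"
  unfolding mpoly_eval_def monom_eval_def[symmetric]
  using assms by (intro sum.mono_neutral_left) (auto simp: in_keys_iff)

lemma mpoly_eval_add: "mpoly_eval (p + q) x = mpoly_eval p x + mpoly_eval q x"
proof -
  let ?A = "Poly_Mapping.keys p \<union> Poly_Mapping.keys q"
  have "mpoly_eval (p + q) x = (\<Sum>m\<in>?A. Poly_Mapping.lookup (p + q) m * monom_eval m x)"
    using Poly_Mapping.keys_add[of p q] by (intro mpoly_eval_superset) auto
  also have "\<dots> = mpoly_eval p x + mpoly_eval q x"
    by (simp add: lookup_add algebra_simps sum.distrib mpoly_eval_superset[of ?A])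
  finally show ?thesis .
qed

lemma mpoly_eval_single: "mpoly_eval (Poly_Mapping.single m c) x = c * monom_eval m x"
  by (subst mpoly_eval_superset[of "{m}"]) auto

lemma tendsto_mpoly_eval:
  assumes "\<And>i. filterlim (\<lambda>s. u s i) (nhds (x i)) G"
  shows "filterlim (\<lambda>s. mpoly_eval p (u s)) (nhds (mpoly_eval p x)) G"
  unfolding mpoly_eval_def by (intro tendsto_intros assms)

text \<open>Rationality over \<open>F\<close> is tracked on functions; formal polynomials are
  recovered only when unirationality is concluded.\<close>

definition polyfuns :: "complex set \<Rightarrow> nat \<Rightarrow> ((nat \<Rightarrow> complex) \<Rightarrow> complex) set" where
  "polyfuns F n = mpoly_eval ` mpolys F n"

lemma polyfunE:
  assumes "f \<in> polyfuns F n"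
  obtains p where "p \<in> mpolys F n" "\<And>x. mpoly_eval p x = f x"
  using assms by (auto simp: polyfuns_def)

section \<open>Polynomial functions with coefficients in a subfield of the complex numbers\<close>

locale complex_subfield =
  fixes F :: "complex set"
  assumes zero_mem: "0 \<in> F" and one_mem: "1 \<in> F"
    and add_mem: "\<And>x y. x \<in> F \<Longrightarrow> y \<in> F \<Longrightarrow> x + y \<in> F"
    and mult_mem: "\<And>x y. x \<in> F \<Longrightarrow> y \<in> F \<Longrightarrow> x * y \<in> F"
    and uminus_mem: "\<And>x. x \<in> F \<Longrightarrow> - x \<in> F"
    and inverse_mem: "\<And>x. x \<in> F \<Longrightarrow> inverse x \<in> F"
begin

lemma diff_mem: "x \<in> F \<Longrightarrow> y \<in> F \<Longrightarrow> x - y \<in> F"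
  using add_mem[of x "- y"] uminus_mem by simp

lemma divide_mem: "x \<in> F \<Longrightarrow> y \<in> F \<Longrightarrow> x / y \<in> F"
  by (simp add: divide_inverse mult_mem inverse_mem)

lemma power_mem: "x \<in> F \<Longrightarrow> x ^ n \<in> F"
  by (induction n) (auto intro: one_mem mult_mem)

lemma of_nat_mem: "of_nat n \<in> F"
  by (induction n) (auto intro: zero_mem one_mem add_mem)

lemma numeral_mem: "numeral n \<in> F"
  using of_nat_mem[of "numeral n"] by simp

lemmas mem_intros = zero_mem one_mem add_mem mult_mem uminus_mem diff_mem divide_mem power_mem
  numeral_mem

lemma polyfun_monom:
  assumes "c \<in> F" "Poly_Mapping.keys m \<subseteq> {..<n}"
  shows "(\<lambda>x. c * monom_eval m x) \<in> polyfuns F n"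
proof -
  have "Poly_Mapping.single m c \<in> mpolys F n"
    using assms by (auto simp: mpolys_def lookup_single when_def zero_mem)
  moreover have "mpoly_eval (Poly_Mapping.single m c) = (\<lambda>x. c * monom_eval m x)"
    by (simp add: fun_eq_iff mpoly_eval_single)
  ultimately show ?thesis unfolding polyfuns_def by (metis imageI)
qed

lemma polyfun_const: "c \<in> F \<Longrightarrow> (\<lambda>_. c) \<in> polyfuns F n"
  using polyfun_monom[of c 0 n] by (simp add: monom_eval_def)

lemma polyfun_var: "i < n \<Longrightarrow> (\<lambda>x. x i) \<in> polyfuns F n"
  using polyfun_monom[of 1 "Poly_Mapping.single i 1" n] by (simp add: monom_eval_def one_mem)

lemma polyfun_add:
  assumes "f \<in> polyfuns F n" "g \<in> polyfuns F n"
  shows "(\<lambda>x. f x + g x) \<in> polyfuns F n"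
proof -
  obtain p where p: "p \<in> mpolys F n" "\<And>x. mpoly_eval p x = f x"
    using polyfunE[OF assms(1)] by blast
  obtain q where q: "q \<in> mpolys F n" "\<And>x. mpoly_eval q x = g x"
    using polyfunE[OF assms(2)] by blast
  have "p + q \<in> mpolys F n"
    using p(1) q(1) Poly_Mapping.keys_add[of p q]
    unfolding mpolys_def by (auto simp: lookup_add intro: add_mem) blast
  moreover have "mpoly_eval (p + q) = (\<lambda>x. f x + g x)"
    by (simp add: fun_eq_iff mpoly_eval_add p q)
  ultimately show ?thesis unfolding polyfuns_def by (metis imageI)
qed

lemma polyfun_sum:
  assumes "finite A" "\<And>a. a \<in> A \<Longrightarrow> f a \<in> polyfuns F n"
  shows "(\<lambda>x. \<Sum>a\<in>A. f a x) \<in> polyfuns F n"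
  using assms
proof (induction A rule: finite_induct)
  case empty
  then show ?case using polyfun_const[OF zero_mem] by simp
next
  case (insert a A)
  then show ?case using polyfun_add[of "f a" n "\<lambda>x. \<Sum>a\<in>A. f a x"] by simp
qed

text \<open>Expanding the product into a double sum of monomials reduces the claim to closure under
  sums.\<close>

lemma polyfun_mult:
  assumes "f \<in> polyfuns F n" "g \<in> polyfuns F n"
  shows "(\<lambda>x. f x * g x) \<in> polyfuns F n"
proof -
  obtain p where p: "p \<in> mpolys F n" "\<And>x. mpoly_eval p x = f x"
    using polyfunE[OF assms(1)] by blast
  obtain q where q: "q \<in> mpolys F n" "\<And>x. mpoly_eval q x = g x"
    using polyfunE[OF assms(2)] by blast
  have "f x * g x = (\<Sum>m\<in>Poly_Mapping.keys p. \<Sum>m'\<in>Poly_Mapping.keys q.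
      (Poly_Mapping.lookup p m * Poly_Mapping.lookup q m') * monom_eval (m + m') x)" for x
    unfolding p(2)[symmetric] q(2)[symmetric] mpoly_eval_def monom_eval_def[symmetric]
    by (simp add: sum_product monom_eval_add mult_ac)
  moreover have "Poly_Mapping.keys (m + m') \<subseteq> {..<n}"
    if "m \<in> Poly_Mapping.keys p" "m' \<in> Poly_Mapping.keys q" for m m'
    using that p(1) q(1) Poly_Mapping.keys_add[of m m'] by (fastforce simp: mpolys_def)
  ultimately show ?thesis
    using p(1) q(1) by (auto intro!: polyfun_sum polyfun_monom mult_mem simp: mpolys_def)
qed

lemma polyfun_power: "f \<in> polyfuns F n \<Longrightarrow> (\<lambda>x. f x ^ j) \<in> polyfuns F n"
  by (induction j) (auto intro: polyfun_mult polyfun_const one_mem)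

lemma polyfun_uminus: "f \<in> polyfuns F n \<Longrightarrow> (\<lambda>x. - f x) \<in> polyfuns F n"
  using polyfun_mult[OF polyfun_const[OF uminus_mem[OF one_mem]], of f n] by simp

lemma polyfun_diff:
  "f \<in> polyfuns F n \<Longrightarrow> g \<in> polyfuns F n \<Longrightarrow> (\<lambda>x. f x - g x) \<in> polyfuns F n"
  using polyfun_add[OF _ polyfun_uminus, of f n g] by simp

lemmas polyfun_intros = polyfun_var polyfun_add polyfun_mult polyfun_power polyfun_uminus
  polyfun_diff polyfun_const

text \<open>All components share one denominator \<open>D\<close>; a single point with
  \<open>D x \<noteq> 0\<close> certifies that the formal polynomial behind it is not zero.\<close>

lemma unirationalI:
  assumes "\<And>i. i < m \<Longrightarrow> N i \<in> polyfuns F n" "D \<in> polyfuns F n" "D x \<noteq> 0"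
    and "\<And>y. y \<in> affine_space n \<Longrightarrow> D y \<noteq> 0 \<Longrightarrow> (\<lambda>i\<in>{..<m}. N i y / D y) \<in> V"
    and "V \<subseteq> zariski_closure m ((\<lambda>y. \<lambda>i\<in>{..<m}. N i y / D y) ` {y \<in> affine_space n. D y \<noteq> 0})"
    and "0 < m"
  shows "unirational F m V"
proof -
  have "\<forall>i. \<exists>p. i < m \<longrightarrow> p \<in> mpolys F n \<and> (\<forall>x. mpoly_eval p x = N i x)"
    using assms(1) polyfunE by metis
  then obtain p where p: "\<And>i. i < m \<Longrightarrow> p i \<in> mpolys F n"
      "\<And>i x. i < m \<Longrightarrow> mpoly_eval (p i) x = N i x"
    by metis
  obtain q where q: "q \<in> mpolys F n" "\<And>x. mpoly_eval q x = D x"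
    using polyfunE[OF assms(2)] by blast
  have "q \<noteq> 0" using q(2)[of x] assms(3) by (auto simp: mpoly_eval_def)
  moreover have "ratmap_image n m p (\<lambda>_. q) =
      (\<lambda>y. \<lambda>i\<in>{..<m}. N i y / D y) ` {y \<in> affine_space n. D y \<noteq> 0}"
    unfolding ratmap_image_def using \<open>0 < m\<close>
    by (intro image_cong) (auto simp: p q fun_eq_iff restrict_def)
  ultimately show ?thesis
    unfolding unirational_def using p(1) q(1) assms(4,5)
    by (intro exI[of _ n] exI[of _ p] exI[of _ "\<lambda>_. q"]) auto
qed

end

lemma complex_subfield_number_field:
  assumes "real_number_field k"
  shows "complex_subfield (complex_of_real ` k)"
proof -
  have sf: "subfield k ring_of_type_algebra"
    using assms by (simp add: real_number_field_def)
  then have sr: "subring k ring_of_type_algebra"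
    by (auto simp: subfield_def subdomain_def subcring_def)
  note E = subringE[OF sr, unfolded ring_of_type_algebra_def, simplified]
  have inv: "inverse x \<in> k" if "x \<in> k" for x
  proof (cases "x = 0")
    case False
    \<comment> \<open>The inverse taken in the ring with carrier \<open>k\<close> must agree with
      the real inverse, because inverses are unique.\<close>
    have "x \<in> Units (ring_of_type_algebra \<lparr>carrier := k\<rparr>)"
      using subfield.subfield_Units[OF sf] that False by (simp add: ring_of_type_algebra_def)
    then obtain y where "y \<in> k" "y * x = 1"
      by (auto simp: Units_def ring_of_type_algebra_def)
    then show ?thesis by (metis inverse_unique mult.commute)
  qed (use that in simp)
  have neg: "- x \<in> k" if "x \<in> k" for x
  proof -
    interpret cring "ring_of_type_algebra :: real ring" by (rule cring_from_type_algebra)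
    have "\<ominus>\<^bsub>ring_of_type_algebra\<^esub> x \<in> k" using subringE(5)[OF sr] that by simp
    moreover have "\<ominus>\<^bsub>ring_of_type_algebra\<^esub> x = - x"
      by (rule minus_equality) (auto simp: ring_of_type_algebra_def)
    ultimately show ?thesis by simp
  qed
  show ?thesis
    by unfold_locales (auto intro!: imageI E inv neg
        simp flip: of_real_add of_real_mult of_real_minus of_real_inverse
        intro: image_eqI[where x=0] image_eqI[where x=1])
qed

subsection \<open>The norm form of a pure cubic extension\<close>

text \<open>Elements \<open>x 0 + x 1 \<beta> + x 2 \<beta>\<^sup>2\<close> with \<open>\<beta>\<^sup>3 = m\<close> are encoded by their coordinates \<open>x\<close>.\<close>

definition cubic_mult :: "complex \<Rightarrow> (nat \<Rightarrow> complex) \<Rightarrow> (nat \<Rightarrow> complex) \<Rightarrow> nat \<Rightarrow> complex" where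
  "cubic_mult m x y i =
     (if i = 0 then x 0 * y 0 + m * (x 1 * y 2 + x 2 * y 1)
      else if i = 1 then x 0 * y 1 + x 1 * y 0 + m * (x 2 * y 2)
      else x 0 * y 2 + x 1 * y 1 + x 2 * y 0)"

text \<open>The norm form for \<open>\<beta>\<^sup>3 = m\<close>. The left-hand side of the
  hypersurface equation is the case \<open>m = - b\<close>.\<close>

definition cubic_norm :: "complex \<Rightarrow> (nat \<Rightarrow> complex) \<Rightarrow> complex" where
  "cubic_norm m x = x 0 ^ 3 + m * x 1 ^ 3 + m ^ 2 * x 2 ^ 3 - 3 * m * x 0 * x 1 * x 2"

definition cubic_eval :: "complex \<Rightarrow> (nat \<Rightarrow> complex) \<Rightarrow> complex" where
  "cubic_eval \<beta> x = x 0 + \<beta> * x 1 + \<beta> ^ 2 * x 2"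

lemma cubic_norm_mult: "cubic_norm m (cubic_mult m x y) = cubic_norm m x * cubic_norm m y"
proof -
  have "(x0 * y0 + m * (x1 * y2 + x2 * y1)) ^ 3 + m * (x0 * y1 + x1 * y0 + m * (x2 * y2)) ^ 3 +
      m ^ 2 * (x0 * y2 + x1 * y1 + x2 * y0) ^ 3 -
      3 * m * (x0 * y0 + m * (x1 * y2 + x2 * y1)) * (x0 * y1 + x1 * y0 + m * (x2 * y2)) *
      (x0 * y2 + x1 * y1 + x2 * y0) =
      (x0 ^ 3 + m * x1 ^ 3 + m ^ 2 * x2 ^ 3 - 3 * m * x0 * x1 * x2) *
      (y0 ^ 3 + m * y1 ^ 3 + m ^ 2 * y2 ^ 3 - 3 * m * y0 * y1 * y2)"
    for x0 x1 x2 y0 y1 y2 :: complex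
    by Groebner_Basis.algebra
  \<comment> \<open>The instantiation follows the order in which the variables first occur in the
    identity.\<close>
  from this[of "x 0" "y 0" "x 1" "y 2" "x 2" "y 1"] show ?thesis
    by (simp add: cubic_norm_def cubic_mult_def)
qed

lemma cubic_norm_scale: "cubic_norm m (\<lambda>i. x i / c) = cubic_norm m x / c ^ 3"
  unfolding cubic_norm_def
  by (simp add: power_divide add_divide_distrib diff_divide_distrib) (simp add: power3_eq_cube)

lemma cubic_mult_scale: "cubic_mult m (\<lambda>i. x i / c) y i = cubic_mult m x y i / c"
  unfolding cubic_mult_def by (simp add: divide_inverse algebra_simps)

lemma cubic_mult_cong:
  assumes "\<And>i. i < 3 \<Longrightarrow> x i = x' i" "\<And>i. i < 3 \<Longrightarrow> y i = y' i"
  shows "cubic_mult m x y = cubic_mult m x' y'"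
  using assms by (simp add: cubic_mult_def fun_eq_iff)

lemma cubic_norm_cong:
  assumes "\<And>i. i < 3 \<Longrightarrow> x i = x' i"
  shows "cubic_norm m x = cubic_norm m x'"
  using assms by (simp add: cubic_norm_def)

lemma cubic_eval_mult:
  assumes "\<beta> ^ 3 = m"
  shows "cubic_eval \<beta> (cubic_mult m x y) = cubic_eval \<beta> x * cubic_eval \<beta> y"
  unfolding cubic_eval_def cubic_mult_def assms[symmetric]
  by (simp add: power2_eq_square power3_eq_cube algebra_simps)

lemma (in complex_subfield) polyfun_cubic_mult:
  assumes "m \<in> F" "\<And>i. i < 3 \<Longrightarrow> (\<lambda>x. y x i) \<in> polyfuns F n" "\<And>i. i < 3 \<Longrightarrow> (\<lambda>x. z x i) \<in> polyfuns F n"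
  shows "(\<lambda>x. cubic_mult m (y x) (z x) i) \<in> polyfuns F n"
proof -
  consider "i = 0" | "i = 1" | "i \<noteq> 0" "i \<noteq> 1" by blast
  then show ?thesis
    using assms(1) by cases (auto simp: cubic_mult_def intro!: polyfun_intros assms(2,3))
qed

lemma (in complex_subfield) polyfun_cubic_norm:
  assumes "m \<in> F" "\<And>i. i < 3 \<Longrightarrow> (\<lambda>x. y x i) \<in> polyfuns F n"
  shows "(\<lambda>x. cubic_norm m (y x)) \<in> polyfuns F n"
  unfolding cubic_norm_def by (intro polyfun_intros assms mem_intros) simp_all

section \<open>Splitting the cubic algebra into three complex factors\<close>

locale cube_roots =
  fixes m \<beta> \<omega> :: complex
  assumes \<beta>: "\<beta> ^ 3 = m" and m_nonzero: "m \<noteq> 0" and \<omega>: "\<omega> ^ 2 + \<omega> + 1 = 0"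
begin

abbreviation "\<sigma> j \<equiv> cubic_eval (\<beta> * \<omega> ^ j)"

lemma omega_cubed: "\<omega> ^ 3 = 1"
  using \<omega> by Groebner_Basis.algebra

lemma omega_squared: "\<omega> ^ 2 = - 1 - \<omega>"
  using \<omega> by Groebner_Basis.algebra

lemma omega_fourth: "\<omega> ^ 4 = \<omega>"
  using \<omega> by Groebner_Basis.algebra

lemma eval_expand:
  "cubic_eval (\<beta> * \<omega> ^ 0) x = x 0 + \<beta> * x 1 + \<beta> ^ 2 * x 2"
  "cubic_eval (\<beta> * \<omega> ^ 1) x = x 0 + \<omega> * (\<beta> * x 1) + \<omega> ^ 2 * (\<beta> ^ 2 * x 2)"
  "cubic_eval (\<beta> * \<omega> ^ 2) x = x 0 + \<omega> ^ 2 * (\<beta> * x 1) + \<omega> * (\<beta> ^ 2 * x 2)"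
  unfolding cubic_eval_def by (simp_all add: power_mult_distrib omega_fourth del: One_nat_def)

lemma root_cubed: "(\<beta> * \<omega> ^ j) ^ 3 = m"
  by (metis \<beta> omega_cubed mult.commute mult.right_neutral power_mult power_mult_distrib power_one)

lemma eval_mult: "\<sigma> j (cubic_mult m x y) = \<sigma> j x * \<sigma> j y"
  by (rule cubic_eval_mult[OF root_cubed])

text \<open>This is the factorization of \<open>a^3 + b^3 + c^3 - 3abc\<close> over the cube roots
  of unity, at \<open>a = x 0\<close>, \<open>b = \<beta> * x 1\<close>,
  \<open>c = \<beta>^2 * x 2\<close>.\<close>

lemma norm_eq_prod: "cubic_norm m x = \<sigma> 0 x * \<sigma> 1 x * \<sigma> 2 x"
proof -
  have split: "a ^ 3 + b ^ 3 + c ^ 3 - 3 * a * b * c =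
      (a + b + c) * (a + \<omega> * b + \<omega> ^ 2 * c) * (a + \<omega> ^ 2 * b + \<omega> * c)" for a b c
  proof -
    have o: "\<omega> * \<omega> = - 1 - \<omega>" using omega_squared by (simp add: power2_eq_square)
    then have o': "\<omega> * (\<omega> * z) = - z - \<omega> * z" for z by Groebner_Basis.algebra
    show ?thesis by (simp add: power2_eq_square power3_eq_cube algebra_simps o o')
  qed
  have "(\<beta> * x 1) ^ 3 = m * x 1 ^ 3" by (simp add: power_mult_distrib \<beta>)
  moreover have "(\<beta> ^ 2 * x 2) ^ 3 = m ^ 2 * x 2 ^ 3"
    by (metis \<beta> mult.commute power_mult power_mult_distrib)
  moreover have "3 * x 0 * (\<beta> * x 1) * (\<beta> ^ 2 * x 2) = 3 * m * x 0 * x 1 * x 2"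
    unfolding \<beta>[symmetric] by (simp add: power2_eq_square power3_eq_cube)
  ultimately show ?thesis
    unfolding cubic_norm_def eval_expand
    using split[of "x 0" "\<beta> * x 1" "\<beta> ^ 2 * x 2"] by (simp only:)
qed

text \<open>The inverse discrete Fourier transform of order 3, rescaled by powers of
  \<open>\<beta>\<close>.\<close>

definition inv_eval :: "complex \<Rightarrow> complex \<Rightarrow> complex \<Rightarrow> nat \<Rightarrow> complex" where
  "inv_eval y0 y1 y2 i =
     (if i = 0 then (y0 + y1 + y2) / 3
      else if i = 1 then (y0 + \<omega> ^ 2 * y1 + \<omega> * y2) / (3 * \<beta>)
      else (y0 + \<omega> * y1 + \<omega> ^ 2 * y2) / (3 * \<beta> ^ 2))"

lemma beta_nonzero: "\<beta> \<noteq> 0"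
  using \<beta> m_nonzero by auto

lemma eval_inv_eval:
  "\<sigma> 0 (inv_eval y0 y1 y2) = y0" "\<sigma> 1 (inv_eval y0 y1 y2) = y1" "\<sigma> 2 (inv_eval y0 y1 y2) = y2"
proof -
  have c: "inv_eval y0 y1 y2 0 = (y0 + y1 + y2) / 3"
     "\<beta> * inv_eval y0 y1 y2 1 = (y0 + \<omega> ^ 2 * y1 + \<omega> * y2) / 3"
     "\<beta> ^ 2 * inv_eval y0 y1 y2 2 = (y0 + \<omega> * y1 + \<omega> ^ 2 * y2) / 3"
    using beta_nonzero by (simp_all add: inv_eval_def)
  \<comment> \<open>Treating one third as an unknown \<open>q\<close> with \<open>3 * q = 1\<close>
    leaves purely polynomial goals.\<close>
  define q :: complex where "q = 1 / 3"
  have q: "3 * q = 1" and div: "y / 3 = q * y" for y by (simp_all add: q_def)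
  show "\<sigma> 0 (inv_eval y0 y1 y2) = y0" "\<sigma> 1 (inv_eval y0 y1 y2) = y1"
    "\<sigma> 2 (inv_eval y0 y1 y2) = y2"
    unfolding eval_expand c div
    using q \<omega> by Groebner_Basis.algebra+
qed

text \<open>Adding the three equations with weights that are powers of \<open>\<omega>\<close>
  isolates three times each term.\<close>

lemma eval_inject:
  assumes "\<And>j. j < 3 \<Longrightarrow> \<sigma> j x = \<sigma> j y" "i < 3"
  shows "x i = y i"
proof -
  have e: "\<sigma> 0 x = \<sigma> 0 y" "\<sigma> 1 x = \<sigma> 1 y" "\<sigma> 2 x = \<sigma> 2 y"
    by (rule assms(1), simp)+
  have "a = a' \<and> b = b' \<and> c = c'" if "a + b + c = a' + b' + c'"
      "a + \<omega> * b + \<omega> ^ 2 * c = a' + \<omega> * b' + \<omega> ^ 2 * c'"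
      "a + \<omega> ^ 2 * b + \<omega> * c = a' + \<omega> ^ 2 * b' + \<omega> * c'" for a b c a' b' c'
  proof -
    have "3 * a = 3 * a'" "3 * b = 3 * b'" "3 * c = 3 * c'"
      using that \<omega> by Groebner_Basis.algebra+
    then show ?thesis by simp
  qed
  from this[of "x 0" "\<beta> * x 1" "\<beta> ^ 2 * x 2" "y 0" "\<beta> * y 1" "\<beta> ^ 2 * y 2"]
  have "x 0 = y 0 \<and> \<beta> * x 1 = \<beta> * y 1 \<and> \<beta> ^ 2 * x 2 = \<beta> ^ 2 * y 2"
    using e unfolding eval_expand by blast
  then have "x 0 = y 0" "x 1 = y 1" "x 2 = y 2"
    using beta_nonzero by simp_all
  then show ?thesis
    using assms(2) by (auto simp: less_Suc_eq numeral_3_eq_3 numeral_2_eq_2)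
qed

lemma norm_inv_eval: "cubic_norm m (inv_eval y0 y1 y2) = y0 * y1 * y2"
  by (simp only: norm_eq_prod eval_inv_eval)

lemma inv_eval_eval: "i < 3 \<Longrightarrow> inv_eval (\<sigma> 0 x) (\<sigma> 1 x) (\<sigma> 2 x) i = x i"
proof (rule eval_inject)
  fix j :: nat assume "j < 3"
  then consider "j = 0" | "j = 1" | "j = 2" by linarith
  then show "\<sigma> j (inv_eval (\<sigma> 0 x) (\<sigma> 1 x) (\<sigma> 2 x)) = \<sigma> j x"
    by cases (simp_all only: eval_inv_eval)
qed

text \<open>In split coordinates the condition reads \<open>u z\<^sup>3 = x\<close> with \<open>N(z) = 1\<close>: choose two cube roots
  freely, and the third so that the product is 1.\<close>
lemma same_norm_imp_cube_multiple:
  assumes "cubic_norm m x = cubic_norm m u" "cubic_norm m u \<noteq> 0"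
  shows "\<exists>z. cubic_norm m z = 1 \<and>
    (\<forall>i<3. cubic_mult m u (cubic_mult m z (cubic_mult m z z)) i = x i)"
proof -
  have u: "\<sigma> 0 u \<noteq> 0" "\<sigma> 1 u \<noteq> 0" "\<sigma> 2 u \<noteq> 0"
    using assms(2) by (auto simp: norm_eq_prod)
  have x: "\<sigma> 0 x \<noteq> 0" "\<sigma> 1 x \<noteq> 0" "\<sigma> 2 x \<noteq> 0"
    using assms by (auto simp: norm_eq_prod)
  obtain z0 where z0: "z0 ^ 3 = \<sigma> 0 x / \<sigma> 0 u" using nth_root_exists[of 3] by auto
  obtain z1 where z1: "z1 ^ 3 = \<sigma> 1 x / \<sigma> 1 u" using nth_root_exists[of 3] by auto
  have nz: "z0 \<noteq> 0" "z1 \<noteq> 0" using z0 z1 x u by auto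
  define z where "z = inv_eval z0 z1 (1 / (z0 * z1))"
  have z: "\<sigma> 0 z = z0" "\<sigma> 1 z = z1" "\<sigma> 2 z = 1 / (z0 * z1)"
    unfolding z_def by (fact eval_inv_eval)+
  \<comment> \<open>The third cube equation is automatic: equal norms make the three quotients
    multiply to 1.\<close>
  have z2: "(1 / (z0 * z1)) ^ 3 = \<sigma> 2 x / \<sigma> 2 u"
    using assms x u unfolding power_divide power_mult_distrib z0 z1 norm_eq_prod
    by (simp add: field_simps)
  have "cubic_mult m u (cubic_mult m z (cubic_mult m z z)) i = x i" if "i < 3" for i
  proof (rule eval_inject[OF _ that])
    fix j :: nat assume "j < 3"
    then consider "j = 0" | "j = 1" | "j = 2" by linarith
    then have "\<sigma> j z ^ 3 = \<sigma> j x / \<sigma> j u"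
      by cases (simp_all only: z z0 z1 z2)
    moreover have "\<sigma> j u \<noteq> 0" using u \<open>j < 3\<close> by (cases rule: linorder_cases[of j 1])
        (auto simp: less_Suc_eq numeral_3_eq_3 numeral_2_eq_2)
    ultimately show "\<sigma> j (cubic_mult m u (cubic_mult m z (cubic_mult m z z))) = \<sigma> j x"
      by (simp add: eval_mult power3_eq_cube field_simps)
  qed
  moreover have "cubic_norm m z = 1"
    unfolding norm_eq_prod z using nz by simp
  ultimately show ?thesis by blast
qed

end

lemma cube_roots_exist:
  assumes "m \<noteq> (0 :: complex)"
  shows "\<exists>\<beta> \<omega>. cube_roots m \<beta> \<omega>"
proof -
  obtain \<beta> where "\<beta> ^ 3 = m" using nth_root_exists[of 3 m] by auto
  moreover obtain \<omega> :: complex where "poly [:1, 1, 1:] \<omega> = 0"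
    using alg_closed_imp_poly_has_root[of "[:1, 1, 1:] :: complex poly"] by auto
  ultimately have "cube_roots m \<beta> \<omega>"
    using assms by unfold_locales (auto simp: algebra_simps power2_eq_square)
  then show ?thesis by blast
qed

subsection \<open>Density in the hypersurface\<close>

text \<open>A finite set does not accumulate at \<open>a\<close>, so \<open>h\<close> vanishes on a
  punctured neighbourhood of \<open>a\<close>, and continuity gives the value at
  \<open>a\<close>.\<close>

lemma isCont_zero_outside_finite:
  fixes h :: "complex \<Rightarrow> complex"
  assumes "isCont h a" "finite S" "\<And>t. t \<notin> S \<Longrightarrow> h t = 0"
  shows "h a = 0"
proof (rule ccontr)
  assume "h a \<noteq> 0"
  then have "eventually (\<lambda>t. h t \<noteq> 0) (at a)"
    using assms(1) by (simp add: isCont_def tendsto_imp_eventually_ne)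
  moreover have "open (- (S - {a}))"
    by (intro open_Compl finite_imp_closed) (use assms(2) in simp)
  then have "eventually (\<lambda>t. t \<in> - (S - {a})) (nhds a)"
    by (rule eventually_nhds_in_open) simp
  then have "eventually (\<lambda>t. h t = 0) (at a)"
    unfolding eventually_at_filter by eventually_elim (use assms(3) in auto)
  ultimately have "eventually (\<lambda>t::complex. False) (at a)"
    by eventually_elim auto
  then show False by simp
qed

text \<open>Every point is reached as a limit along a curve inside the hypersurface
  \<open>y0 * y1 * y2 = g t\<close>. If two coordinates are nonzero, \<open>t\<close> moves and the
  third coordinate is solved for; otherwise \<open>g t = 0\<close> and the curve stays in the fibre
  over \<open>t\<close>.\<close>

lemma split_form_density:
  fixes h :: "complex \<Rightarrow> complex \<Rightarrow> complex \<Rightarrow> complex \<Rightarrow> complex" and g :: "complex \<Rightarrow> complex"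
  assumes cont: "\<And>(fp :: complex \<Rightarrow> complex) fq fr fs a.
      isCont fp a \<Longrightarrow> isCont fq a \<Longrightarrow> isCont fr a \<Longrightarrow> isCont fs a \<Longrightarrow>
      isCont (\<lambda>s. h (fp s) (fq s) (fr s) (fs s)) a"
    and g: "\<And>t. isCont g t" and "finite S"
    and zero: "\<And>y0 y1 y2 t. t \<notin> S \<Longrightarrow> y0 * y1 * y2 = g t \<Longrightarrow> h y0 y1 y2 t = 0"
    and eq: "y0 * y1 * y2 = g t"
  shows "h y0 y1 y2 t = 0"
proof -
  have lim: "h (fp a) (fq a) (fr a) (fs a) = 0"
    if "isCont fp a" "isCont fq a" "isCont fr a" "isCont fs a"
      "finite B" "\<And>s. s \<notin> B \<Longrightarrow> h (fp s) (fq s) (fr s) (fs s) = 0" for fp fq fr fs :: "complex \<Rightarrow> complex" and a B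
    using isCont_zero_outside_finite[OF cont[OF that(1-4)] that(5,6)] by simp
  have one: "h (g t / (u * w)) u w t = 0" if "u \<noteq> 0" "w \<noteq> 0" for u w t
    by (rule lim[where fp = "\<lambda>t. g t / (u * w)" and fq = "\<lambda>_. u" and fr = "\<lambda>_. w" and fs = "\<lambda>t. t"])
       (rule continuous_intros g \<open>finite S\<close> zero | use that in simp)+
  have two: "h u (g t / (u * w)) w t = 0" if "u \<noteq> 0" "w \<noteq> 0" for u w t
    by (rule lim[where fp = "\<lambda>_. u" and fq = "\<lambda>t. g t / (u * w)" and fr = "\<lambda>_. w" and fs = "\<lambda>t. t"])
       (rule continuous_intros g \<open>finite S\<close> zero | use that in simp)+
  have three: "h u w (g t / (u * w)) t = 0" if "u \<noteq> 0" "w \<noteq> 0" for u w t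
    by (rule lim[where fp = "\<lambda>_. u" and fq = "\<lambda>_. w" and fr = "\<lambda>t. g t / (u * w)" and fs = "\<lambda>t. t"])
       (rule continuous_intros g \<open>finite S\<close> zero | use that in simp)+
  have pair: "h 0 0 w t = 0" "h 0 w 0 t = 0" "h w 0 0 t = 0" if "w \<noteq> 0" "g t = 0" for w
  proof -
    \<comment> \<open>With two nonzero coordinates and \<open>g t = 0\<close>, the solved coordinate
      is 0. Letting \<open>u\<close> tend to 0 then reaches the coordinate axes.\<close>
    have off: "h u 0 w t = 0" "h u w 0 t = 0" "h w u 0 t = 0" if "u \<noteq> 0" for u
      using two[of u w t] three[of u w t] three[of w u t] that \<open>w \<noteq> 0\<close> \<open>g t = 0\<close> by simp_all
    show "h 0 0 w t = 0"
      by (rule lim[where fp = "\<lambda>s. s" and fq = "\<lambda>_. 0" and fr = "\<lambda>_. w" and fs = "\<lambda>_. t" and B = "{0}"])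
         (simp_all add: off)
    show "h 0 w 0 t = 0"
      by (rule lim[where fp = "\<lambda>s. s" and fq = "\<lambda>_. w" and fr = "\<lambda>_. 0" and fs = "\<lambda>_. t" and B = "{0}"])
         (simp_all add: off)
    show "h w 0 0 t = 0"
      by (rule lim[where fp = "\<lambda>_. w" and fq = "\<lambda>s. s" and fr = "\<lambda>_. 0" and fs = "\<lambda>_. t" and B = "{0}"])
         (simp_all add: off)
  qed
  have origin: "h 0 0 0 t = 0" if "g t = 0"
    by (rule lim[where fp = "\<lambda>_. 0" and fq = "\<lambda>_. 0" and fr = "\<lambda>s. s" and fs = "\<lambda>_. t" and B = "{0}"])
       (simp_all add: pair that)
  consider "y1 \<noteq> 0" "y2 \<noteq> 0" | "y0 \<noteq> 0" "y2 \<noteq> 0" | "y0 \<noteq> 0" "y1 \<noteq> 0"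
    | "y0 = 0" "y1 = 0" "y2 \<noteq> 0" | "y0 = 0" "y1 \<noteq> 0" "y2 = 0" | "y0 \<noteq> 0" "y1 = 0" "y2 = 0"
    | "y0 = 0" "y1 = 0" "y2 = 0"
    by blast
  then show ?thesis
  proof cases
    case 1
    then have "y0 = g t / (y1 * y2)" unfolding eq[symmetric] by simp
    with one[OF 1] show ?thesis by metis
  next
    case 2
    then have "y1 = g t / (y0 * y2)" unfolding eq[symmetric] by simp
    with two[OF 2] show ?thesis by metis
  next
    case 3
    then have "y2 = g t / (y0 * y1)" unfolding eq[symmetric] by simp
    with three[OF 3] show ?thesis by metis
  next
    case 4
    then show ?thesis using pair(1)[of y2] eq by simp
  next
    case 5
    then show ?thesis using pair(2)[of y1] eq by simp
  next
    case 6
    then show ?thesis using pair(3)[of y0] eq by simp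
  next
    case 7
    then show ?thesis using origin eq by simp
  qed
qed

section \<open>Transfer of density to the original coordinates\<close>

definition coords4 :: "(nat \<Rightarrow> complex) \<Rightarrow> complex \<Rightarrow> nat \<Rightarrow> complex" where
  "coords4 y t = (\<lambda>i\<in>{..<4}. if i < 3 then y i else t)"

lemma coords4_eq:
  assumes "x \<in> affine_space 4" "\<And>i. i < 3 \<Longrightarrow> x i = y i" "x 3 = t"
  shows "x = coords4 y t"
proof
  fix i :: nat
  consider "i < 3" | "i = 3" | "\<not> i < 4" by linarith
  then show "x i = coords4 y t i"
    using assms by cases (auto simp: coords4_def affine_space_def)
qed

lemma isCont_coords4:
  assumes "\<And>i. i < 3 \<Longrightarrow> isCont (\<lambda>s. y s i) a" "isCont f a"
  shows "isCont (\<lambda>s. coords4 (y s) (f s) i) a"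
proof -
  consider "i < 3" | "i = 3" | "\<not> i < 4" by linarith
  then show ?thesis using assms by cases (simp_all add: coords4_def)
qed

context cube_roots
begin

lemma isCont_inv_eval:
  assumes "isCont f a" "isCont f' a" "isCont f'' a"
  shows "isCont (\<lambda>s. inv_eval (f s) (f' s) (f'' s) i) a"
  unfolding inv_eval_def using assms beta_nonzero by (cases "i = 0"; cases "i = 1") (auto intro!: continuous_intros)

text \<open>The linear change of coordinates \<open>inv_eval\<close> turns the norm equation into
  \<open>y0 * y1 * y2 = g t\<close>, where the limiting argument applies.\<close>

lemma vanishing_extends:
  assumes P: "\<And>y t. t \<notin> S \<Longrightarrow> cubic_norm m y = g t \<Longrightarrow> mpoly_eval P (coords4 y t) = 0"
    and "finite S" and g: "\<And>t. isCont g t" and y: "cubic_norm m y = g t"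
  shows "mpoly_eval P (coords4 y t) = 0"
proof -
  define h where "h y0 y1 y2 t = mpoly_eval P (coords4 (inv_eval y0 y1 y2) t)" for y0 y1 y2 t
  have "h (\<sigma> 0 y) (\<sigma> 1 y) (\<sigma> 2 y) t = 0"
  proof (rule split_form_density[where h = h, OF _ g \<open>finite S\<close>])
    fix fp fq fr fs :: "complex \<Rightarrow> complex" and a
    assume "isCont fp a" "isCont fq a" "isCont fr a" "isCont fs a"
    then have "isCont (\<lambda>s. coords4 (inv_eval (fp s) (fq s) (fr s)) (fs s) i) a" for i
      by (intro isCont_coords4 isCont_inv_eval)
    then show "isCont (\<lambda>s. h (fp s) (fq s) (fr s) (fs s)) a"
      unfolding h_def isCont_def by (intro tendsto_mpoly_eval)
  next
    show "h y0 y1 y2 t = 0" if "t \<notin> S" "y0 * y1 * y2 = g t" for y0 y1 y2 t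
      unfolding h_def using that by (intro P) (simp_all add: norm_inv_eval)
  next
    show "\<sigma> 0 y * \<sigma> 1 y * \<sigma> 2 y = g t"
      using y by (simp only: norm_eq_prod)
  qed
  moreover have "coords4 (inv_eval (\<sigma> 0 y) (\<sigma> 1 y) (\<sigma> 2 y)) t = coords4 y t"
    unfolding coords4_def by (intro restrict_ext) (auto simp only: inv_eval_eval split: if_split)
  ultimately show ?thesis by (simp only: h_def)
qed

end

subsection \<open>Values of a rational function\<close>

text \<open>A root of \<open>T - t E\<close> solves \<open>T = t E\<close>, but it may be a common
  root of \<open>T\<close> and \<open>E\<close>. Common roots are therefore cancelled first, by
  induction on the degree of \<open>E\<close>; the conditions at 0 keep the fraction
  nonconstant.\<close>

lemma ratfun_cofinite_range:
  fixes T E :: "complex poly"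
  assumes "poly T 0 \<noteq> 0" "poly E 0 = 0" "E \<noteq> 0"
  shows "\<exists>S. finite S \<and> (\<forall>t. t \<notin> S \<longrightarrow> (\<exists>v. poly E v \<noteq> 0 \<and> poly T v = t * poly E v))"
  using assms
proof (induction "Polynomial.degree E" arbitrary: T E rule: less_induct)
  case less
  show ?case
  proof (cases "\<exists>c. poly T c = 0 \<and> poly E c = 0")
    case True
    then obtain c where c: "poly T c = 0" "poly E c = 0" by blast
    then obtain T' E' where T': "T = [:- c, 1:] * T'" and E': "E = [:- c, 1:] * E'"
      by (metis poly_eq_0_iff_dvd dvdE)
    \<comment> \<open>This lets the conditions at 0 pass to the reduced pair \<open>T'\<close>,
      \<open>E'\<close>.\<close>
    have "c \<noteq> 0" using c less.prems by auto
    have "E' \<noteq> 0" using E' less.prems by auto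
    then have deg: "Polynomial.degree E' < Polynomial.degree E"
      unfolding E' by (subst degree_mult_eq) auto
    have "poly T 0 = - c * poly T' 0" "poly E 0 = - c * poly E' 0"
      by (simp_all add: T' E')
    then have "poly T' 0 \<noteq> 0" "poly E' 0 = 0"
      using less.prems(1,2) \<open>c \<noteq> 0\<close> by simp_all
    from less.hyps[OF deg this \<open>E' \<noteq> 0\<close>] obtain S where S: "finite S"
      "\<And>t. t \<notin> S \<Longrightarrow> \<exists>v. poly E' v \<noteq> 0 \<and> poly T' v = t * poly E' v"
      by blast
    show ?thesis
    \<comment> \<open>Excluding this value forces \<open>v \<noteq> c\<close>: at \<open>c\<close>
      either \<open>E'\<close> vanishes or the reduced fraction takes exactly this value.\<close>
    proof (intro exI[of _ "insert (poly T' c / poly E' c) S"] conjI allI impI)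
      fix t assume t: "t \<notin> insert (poly T' c / poly E' c) S"
      then obtain v where v: "poly E' v \<noteq> 0" "poly T' v = t * poly E' v" using S(2)[of t] by blast
      then have "v \<noteq> c" using t by auto
      have "poly E v = (v - c) * poly E' v" "poly T v = (v - c) * poly T' v"
        by (simp_all add: T' E' left_diff_distrib)
      then show "\<exists>v. poly E v \<noteq> 0 \<and> poly T v = t * poly E v"
        using v \<open>v \<noteq> c\<close> by (intro exI[of _ v]) simp
    qed (use S in simp)
  next
    case False
    define P where "P t = T - Polynomial.smult t E" for t
    have deg: "Polynomial.degree E > 0"
    proof (rule ccontr)
      assume "\<not> ?thesis"
      then obtain e where "E = [:e:]" using degree_eq_zeroE by blast
      then show False using less.prems by simp
    qed
    \<comment> \<open>Two constant members of the pencil would make \<open>E\<close> constant, so at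
      most one \<open>t\<close> is lost.\<close>
    have uniq: "s = t" if "Polynomial.degree (P s) = 0" "Polynomial.degree (P t) = 0" for s t
    proof (rule ccontr)
      assume "s \<noteq> t"
      have "P s - P t = Polynomial.smult (t - s) E"
        by (simp add: P_def smult_diff_left)
      then have "Polynomial.degree E = Polynomial.degree (P s - P t)" using \<open>s \<noteq> t\<close> by simp
      also have "\<dots> = 0" using that degree_diff_le[of "P s" 0 "P t"] by simp
      finally show False using deg by simp
    qed
    have "\<exists>S. finite S \<and> {t. Polynomial.degree (P t) = 0} \<subseteq> S"
    proof (cases "\<exists>s. Polynomial.degree (P s) = 0")
      case True
      then obtain s where "Polynomial.degree (P s) = 0" ..
      then have "{t. Polynomial.degree (P t) = 0} \<subseteq> {s}" using uniq by blast
      then show ?thesis by blast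
    next
      case False
      then have "{t. Polynomial.degree (P t) = 0} \<subseteq> {}" by blast
      then show ?thesis by blast
    qed
    then obtain S where S: "finite S" "{t. Polynomial.degree (P t) = 0} \<subseteq> S" by blast
    have "\<exists>v. poly E v \<noteq> 0 \<and> poly T v = t * poly E v" if "t \<notin> S" for t
    proof -
      have "Polynomial.degree (P t) > 0" using that S by auto
      then obtain v where "poly (P t) v = 0" using alg_closed_imp_poly_has_root by blast
      then have "poly T v = t * poly E v" by (simp add: P_def)
      moreover from this have "poly E v \<noteq> 0" using False by (metis mult_zero_right)
      ultimately show ?thesis by blast
    qed
    then show ?thesis using S(1) by blast
  qed
qed

subsection \<open>A curve on the hypersurface\<close>

text \<open>With \<open>s = c3 + b v\<^sup>3\<close> and \<open>h = c3 - 2 b v\<^sup>3\<close> put \<open>w = e v / h\<close> and \<open>r = s / (3 b d v)\<close>. Then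
  \<open>g(t) - N(d t\<^sup>2 + p, v t + w, r)\<close> is linear in \<open>t\<close>, with root \<open>T(v) / E(v)\<close>.\<close>
locale sextic =
  fixes b d c2 c3 c4 c5 c6 :: complex
  assumes b: "b \<noteq> 0" and d: "d \<noteq> 0" and c3: "c3 \<noteq> 0" and c5: "3 * d ^ 3 * c5 \<noteq> c2 * c3"
begin

text \<open>\<open>p\<close> is forced by the coefficient of \<open>t^4\<close>; \<open>e\<close> is
  what the terms containing \<open>w\<close> must then supply to the coefficient of
  \<open>t^2\<close>.\<close>

definition "p = c2 / (3 * d ^ 2)"
definition "e = c4 - 3 * d * p ^ 2"
definition "s = [:c3:] + Polynomial.monom b 3"
definition "h = [:c3:] - Polynomial.monom (2 * b) 3"
text \<open>\<open>A\<close> is the coefficient of \<open>t\<close> in the linear remainder, times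
  \<open>h^2\<close>. \<open>E\<close> is that coefficient and \<open>T\<close> minus the constant
  term, both times \<open>h^3 v^3\<close> to clear denominators.\<close>

definition "A = ([:c5:] - Polynomial.smult (p / d) s) * h ^ 2 + Polynomial.monom (3 * b * e ^ 2) 3"
definition "E = A * h * Polynomial.monom 1 3"
definition "T = - (Polynomial.smult (c6 - p ^ 3) (h ^ 3 * Polynomial.monom 1 3)
    + Polynomial.monom (b * e ^ 3) 6 - Polynomial.smult (1 / (27 * b * d ^ 3)) (s ^ 3 * h ^ 3)
    - Polynomial.smult (p * e / d) (s * h ^ 2 * Polynomial.monom 1 3))"

definition g :: "complex \<Rightarrow> complex" where
  "g t = d ^ 3 * t ^ 6 + c2 * t ^ 4 + c3 * t ^ 3 + c4 * t ^ 2 + c5 * t + c6"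

text \<open>The point \<open>(d t^2 + p, v t + w, r)\<close> at \<open>t = T / E\<close>, multiplied
  by \<open>E^2\<close> so that its coordinates are polynomials in \<open>v\<close>.\<close>

definition base :: "complex \<Rightarrow> nat \<Rightarrow> complex" where
  "base v i =
     (if i = 0 then d * poly T v ^ 2 + p * poly E v ^ 2
      else if i = 1 then (v * poly T v + e * v ^ 4 * poly A v) * poly E v
      else poly s v * poly h v * poly A v * v ^ 2 / (3 * b * d) * poly E v)"

lemma poly_s: "poly s v = c3 + b * v ^ 3"
  and poly_h: "poly h v = c3 - 2 * b * v ^ 3"
  and poly_A: "poly A v = (c5 - p / d * poly s v) * poly h v ^ 2 + 3 * b * e ^ 2 * v ^ 3"
  and poly_E: "poly E v = poly A v * poly h v * v ^ 3"
  and poly_T: "poly T v = - ((c6 - p ^ 3) * (poly h v ^ 3 * v ^ 3) + b * e ^ 3 * v ^ 6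
    - 1 / (27 * b * d ^ 3) * (poly s v ^ 3 * poly h v ^ 3)
    - p * e / d * (poly s v * poly h v ^ 2 * v ^ 3))"
  by (simp_all add: s_def h_def A_def E_def T_def poly_monom)

lemma E_zero: "poly E 0 = 0"
  by (simp add: poly_E)

text \<open>At \<open>v = 0\<close> only the summand coming from \<open>r^3\<close> survives,
  because \<open>r\<close> has a pole there; its value is \<open>c3^6 / (27 b d^3)\<close>.\<close>

lemma T_zero: "poly T 0 \<noteq> 0"
  by (simp add: poly_T poly_s poly_h b c3 d)

text \<open>\<open>A\<close> takes the value \<open>(c5 - p c3 / d) c3^2\<close> at 0, which is
  nonzero exactly by the conditions on \<open>c3\<close> and \<open>c5\<close>.\<close>

lemma E_nonzero: "E \<noteq> 0"
proof -
  have "c5 - p / d * c3 \<noteq> 0"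
    using c5 d by (simp add: p_def field_simps power2_eq_square power3_eq_cube)
  then have "poly A 0 \<noteq> 0" by (simp add: poly_A poly_s poly_h c3)
  moreover have "poly h 0 \<noteq> 0" by (simp add: poly_h c3)
  ultimately show ?thesis by (auto simp: E_def)
qed

lemma norm_base:
  assumes E: "poly E v \<noteq> 0"
  shows "cubic_norm (- b) (\<lambda>i. base v i / poly E v ^ 2) = g (poly T v / poly E v)"
proof -
  define t where "t = poly T v / poly E v"
  define S where "S = poly s v"
  define H where "H = poly h v"
  define w where "w = e * v / H"
  define r where "r = S / (3 * b * d * v)"
  have nz: "v \<noteq> 0" "H \<noteq> 0" "poly A v \<noteq> 0"
    using E by (auto simp: poly_E H_def)
  have cancel: "x * poly E v / poly E v ^ 2 = x / poly E v" for x
    using E by (simp add: power2_eq_square)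
  have base0: "base v 0 / poly E v ^ 2 = d * t ^ 2 + p"
    using E by (simp add: base_def t_def power_divide add_divide_distrib)
  have "e * v ^ 4 * poly A v / poly E v = w"
    using nz by (simp add: poly_E w_def flip: H_def) (simp add: eval_nat_numeral)
  then have base1: "base v 1 / poly E v ^ 2 = v * t + w"
    by (simp add: base_def t_def cancel add_divide_distrib)
  have base2: "base v 2 / poly E v ^ 2 = r"
  proof -
    have "base v 2 / poly E v ^ 2 = S * H * poly A v * v ^ 2 / (3 * b * d) / poly E v"
      using cancel[of "S * H * poly A v * v ^ 2 / (3 * b * d)"]
      by (simp only: base_def S_def H_def) simp
    also have "\<dots> = r"
      using nz b d by (simp add: poly_E r_def flip: H_def) (simp add: eval_nat_numeral)
    finally show ?thesis .
  qed
  have r: "3 * b * d * v * r = S" using nz b d by (simp add: r_def)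
  have w: "w * H = e * v" using nz by (simp add: w_def)
  have c2': "c2 = 3 * d ^ 2 * p" using d by (simp add: p_def)
  have c3': "c3 = 3 * b * d * v * r - b * v ^ 3" unfolding r S_def poly_s by simp
  \<comment> \<open>The condition on \<open>t^2\<close> is checked after multiplication by
    \<open>v\<close>, which turns the bracket into \<open>H\<close>.\<close>
  have "v * (w * (3 * b * d * r - 3 * b * v ^ 2)) = v * e"
  proof -
    have "H = S - 3 * b * v ^ 3" by (simp add: H_def S_def poly_h poly_s)
    then have "v * (3 * b * d * r - 3 * b * v ^ 2) = H"
      unfolding r[symmetric] by (simp add: algebra_simps eval_nat_numeral)
    then show ?thesis using w by (metis mult.commute mult.left_commute)
  qed
  then have "w * (3 * b * d * r - 3 * b * v ^ 2) = e" using nz by simp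
  then have c4': "c4 = 3 * d * p ^ 2 + 3 * b * d * w * r - 3 * b * v ^ 2 * w"
    by (simp add: e_def algebra_simps)
  have lin: "(c5 + 3 * b * v * w ^ 2 - 3 * b * p * v * r) * t
      + (c6 - p ^ 3 + b * w ^ 3 - b ^ 2 * r ^ 3 - 3 * b * p * w * r) = 0" (is "?a * t + ?b = 0")
  proof -
    have "3 * b * v * w ^ 2 * H ^ 2 = 3 * b * e ^ 2 * v ^ 3"
      using arg_cong[OF w, of "\<lambda>x. 3 * b * v * x ^ 2"]
      by (simp add: power_mult_distrib eval_nat_numeral mult_ac)
    moreover have pr: "3 * b * p * v * r = p / d * S" using d by (simp flip: r)
    ultimately have a: "?a * H ^ 2 = poly A v"
      by (simp add: poly_A S_def[symmetric] H_def[symmetric] algebra_simps)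
    have "b * w ^ 3 * (H ^ 3 * v ^ 3) = b * e ^ 3 * v ^ 6"
      using arg_cong[OF w, of "\<lambda>x. b * v ^ 3 * x ^ 3"]
      by (simp add: power_mult_distrib eval_nat_numeral mult_ac)
    moreover have "b ^ 2 * r ^ 3 * (H ^ 3 * v ^ 3) = 1 / (27 * b * d ^ 3) * (S ^ 3 * H ^ 3)"
      using b d unfolding r[symmetric] by (simp add: power_mult_distrib eval_nat_numeral)
    moreover have "3 * b * p * w * r * (H ^ 3 * v ^ 3) = p * e / d * (S * H ^ 2 * v ^ 3)"
    proof -
      have "3 * b * p * w * r * (H ^ 3 * v ^ 3) = (3 * b * p * v * r) * (w * H) * H ^ 2 * v ^ 2"
        by (simp add: eval_nat_numeral mult_ac)
      then show ?thesis unfolding pr w by (simp add: eval_nat_numeral mult_ac)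
    qed
    ultimately have "?b * (H ^ 3 * v ^ 3) = - poly T v"
      unfolding poly_T S_def[symmetric] H_def[symmetric] by (simp add: algebra_simps)
    moreover have "?a * t * (H ^ 3 * v ^ 3) = poly T v"
    proof -
      have "?a * t * (H ^ 3 * v ^ 3) = t * ((?a * H ^ 2) * H * v ^ 3)"
        by (simp only: eval_nat_numeral power_Suc power_0 mult_ac)
      also have "\<dots> = t * poly E v" unfolding a by (simp add: poly_E H_def)
      also have "\<dots> = poly T v" using E by (simp add: t_def)
      finally show ?thesis .
    qed
    ultimately have "(?a * t + ?b) * (H ^ 3 * v ^ 3) = 0"
      by (simp only: distrib_right add.right_inverse)
    then show ?thesis using nz by simp
  qed
  \<comment> \<open>Stating this for arbitrary \<open>q\<close>, \<open>k2\<close>,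
    \<open>k3\<close>, \<open>k4\<close> lets the three coefficient relations be substituted as
    plain rewrites, leaving a polynomial identity.\<close>
  have "(d * t ^ 2 + q) ^ 3 - b * (v * t + w) ^ 3 + b ^ 2 * r ^ 3
      + 3 * b * (d * t ^ 2 + q) * (v * t + w) * r
      = d ^ 3 * t ^ 6 + k2 * t ^ 4 + k3 * t ^ 3 + k4 * t ^ 2 + c5 * t + c6
        - ((c5 + 3 * b * v * w ^ 2 - 3 * b * q * v * r) * t
          + (c6 - q ^ 3 + b * w ^ 3 - b ^ 2 * r ^ 3 - 3 * b * q * w * r))"
    if "k2 = 3 * d ^ 2 * q" "k3 = 3 * b * d * v * r - b * v ^ 3"
      "k4 = 3 * d * q ^ 2 + 3 * b * d * w * r - 3 * b * v ^ 2 * w" for k2 k3 k4 q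
    unfolding that by Groebner_Basis.algebra
  note this[OF c2' c3' c4']
  also have "d ^ 3 * t ^ 6 + c2 * t ^ 4 + c3 * t ^ 3 + c4 * t ^ 2 + c5 * t + c6 = g t"
    by (simp only: g_def)
  finally show ?thesis
    unfolding cubic_norm_def base0 base1 base2 t_def[symmetric] lin by simp
qed

lemma norm_base': "poly E v \<noteq> 0 \<Longrightarrow> cubic_norm (- b) (base v) = poly E v ^ 6 * g (poly T v / poly E v)"
  using norm_base[of v] by (simp add: cubic_norm_scale field_simps flip: power_mult)

end

subsection \<open>The dominant map\<close>

context sextic
begin

text \<open>Coordinate 0 is the curve parameter \<open>v\<close>, and coordinates 1 to 3 are those
  of \<open>z\<close>. The factors clear the \<open>E^2\<close> of the curve and the
  \<open>N(z)\<close> in \<open>z^3 / N(z)\<close>.\<close>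

definition param_den :: "(nat \<Rightarrow> complex) \<Rightarrow> complex" where
  "param_den x = poly E (x 0) ^ 2 * cubic_norm (- b) (\<lambda>i. x (Suc i))"

definition param_num :: "nat \<Rightarrow> (nat \<Rightarrow> complex) \<Rightarrow> complex" where
  "param_num i x =
     (if i < 3 then
        cubic_mult (- b) (base (x 0))
          (cubic_mult (- b) (\<lambda>i. x (Suc i)) (cubic_mult (- b) (\<lambda>i. x (Suc i)) (\<lambda>i. x (Suc i)))) i
      else poly T (x 0) * poly E (x 0) * cubic_norm (- b) (\<lambda>i. x (Suc i)))"

lemma param_t:
  assumes "param_den x \<noteq> 0"
  shows "param_num 3 x / param_den x = poly T (x 0) / poly E (x 0)"
  using assms by (simp add: param_num_def param_den_def power2_eq_square)

lemma norm_param: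
  assumes "param_den x \<noteq> 0"
  shows "cubic_norm (- b) (\<lambda>i. param_num i x / param_den x) = g (poly T (x 0) / poly E (x 0))"
proof -
  define z where "z = (\<lambda>i. x (Suc i))"
  define n where "n = cubic_norm (- b) z"
  have nz: "poly E (x 0) \<noteq> 0" "n \<noteq> 0"
    using assms by (auto simp: param_den_def n_def z_def)
  have "cubic_norm (- b) (\<lambda>i. param_num i x / param_den x)
      = cubic_norm (- b) (cubic_mult (- b) (base (x 0)) (cubic_mult (- b) z (cubic_mult (- b) z z))) / param_den x ^ 3"
    unfolding cubic_norm_scale[symmetric]
    by (rule cubic_norm_cong) (simp add: param_num_def z_def)
  also have "\<dots> = poly E (x 0) ^ 6 * g (poly T (x 0) / poly E (x 0)) * n ^ 3
      / (poly E (x 0) ^ 2 * n) ^ 3"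
    using norm_base'[OF nz(1)]
    by (simp add: cubic_norm_mult param_den_def power3_eq_cube flip: n_def z_def)
  also have "(poly E (x 0) ^ 2 * n) ^ 3 = poly E (x 0) ^ 6 * n ^ 3"
    by (simp add: power_mult_distrib flip: power_mult)
  finally show ?thesis using nz by simp
qed

lemma isCont_g: "isCont g t"
  unfolding g_def by (intro continuous_intros)

text \<open>Fibres over roots of \<open>g\<close> are set aside, since the cube multiple argument
  divides by the factors of a nonzero norm.\<close>

lemma finite_roots_g: "finite {t. g t = 0}"
proof -
  define G where "G = Polynomial.monom (d ^ 3) 6 + Polynomial.monom c2 4 + Polynomial.monom c3 3
    + Polynomial.monom c4 2 + Polynomial.monom c5 1 + Polynomial.monom c6 0"
  have "Polynomial.coeff G 6 = d ^ 3" by (simp add: G_def)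
  then have "G \<noteq> 0" using d by auto
  moreover have "g t = poly G t" for t by (simp add: g_def G_def poly_monom)
  ultimately show ?thesis using poly_roots_finite[of G] by simp
qed

text \<open>Choose \<open>v\<close> with \<open>T / E = t\<close>. Then \<open>y\<close> and the
  curve point over \<open>t\<close> have the same nonzero norm, so they differ by a cube
  \<open>z^3\<close> with \<open>N(z) = 1\<close>.\<close>

lemma param_surj:
  "\<exists>S. finite S \<and> (\<forall>t y. t \<notin> S \<longrightarrow> cubic_norm (- b) y = g t \<longrightarrow>
    (\<exists>x\<in>affine_space 4. param_den x \<noteq> 0 \<and>
      (\<lambda>i\<in>{..<4}. param_num i x / param_den x) = coords4 y t))"
proof -
  obtain \<beta> \<omega> where "cube_roots (- b) \<beta> \<omega>" using cube_roots_exist[of "- b"] b by auto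
  then interpret cube_roots "- b" \<beta> \<omega> .
  obtain S where S: "finite S" "\<And>t. t \<notin> S \<Longrightarrow> \<exists>v. poly E v \<noteq> 0 \<and> poly T v = t * poly E v"
    using ratfun_cofinite_range[OF T_zero E_zero E_nonzero] by blast
  have "\<exists>x\<in>affine_space 4. param_den x \<noteq> 0 \<and>
      (\<lambda>i\<in>{..<4}. param_num i x / param_den x) = coords4 y t"
    if t: "t \<notin> S \<union> {t. g t = 0}" and y: "cubic_norm (- b) y = g t" for t y
  proof -
    obtain v where v: "poly E v \<noteq> 0" "poly T v = t * poly E v" using S(2)[of t] t by blast
    then have tv: "poly T v / poly E v = t" by simp
    define u where "u = (\<lambda>i. base v i / poly E v ^ 2)"
    have "cubic_norm (- b) u = g t" unfolding u_def norm_base[OF v(1)] tv ..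
    then obtain z where z: "cubic_norm (- b) z = 1"
      "\<And>i. i < 3 \<Longrightarrow> cubic_mult (- b) u (cubic_mult (- b) z (cubic_mult (- b) z z)) i = y i"
      using same_norm_imp_cube_multiple[of y u] y t by auto
    define x where "x = (\<lambda>i\<in>{..<4}. if i = 0 then v else z (i - 1))"
    have x: "x 0 = v" "\<And>i. i < 3 \<Longrightarrow> x (Suc i) = z i" by (simp_all add: x_def)
    have nx: "cubic_norm (- b) (\<lambda>i. x (Suc i)) = 1"
      using z(1) x(2) cubic_norm_cong[of "\<lambda>i. x (Suc i)" z] by simp
    then have den: "param_den x = poly E v ^ 2" by (simp add: param_den_def x)
    have num: "param_num i x / param_den x = y i" if "i < 3" for i
    proof -
      have "cubic_mult (- b) (\<lambda>i. x (Suc i)) w = cubic_mult (- b) z w" for w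
        by (rule cubic_mult_cong) (simp_all add: x)
      moreover have "cubic_mult (- b) z (\<lambda>i. x (Suc i)) = cubic_mult (- b) z z"
        by (rule cubic_mult_cong) (simp_all add: x)
      ultimately have "param_num i x = cubic_mult (- b) (base v) (cubic_mult (- b) z (cubic_mult (- b) z z)) i"
        using that by (simp add: param_num_def x(1))
      then show ?thesis
        using z(2)[OF that] unfolding u_def cubic_mult_scale den by simp
    qed
    have "param_num 3 x / param_den x = t" using param_t[of x] v den tv x(1) by simp
    then have "(\<lambda>i\<in>{..<4}. param_num i x / param_den x) = coords4 y t"
      using num by (intro coords4_eq) (simp_all add: affine_space_def)
    moreover have "x \<in> affine_space 4" by (simp add: x_def affine_space_def)
    moreover have "param_den x \<noteq> 0" using den v by simp
    ultimately show ?thesis by blast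
  qed
  then show ?thesis
    using S(1) finite_roots_g by (intro exI[of _ "S \<union> {t. g t = 0}"]) blast
qed

lemma unirational_hypersurface:
  assumes "complex_subfield F"
    and mem: "b \<in> F" "d \<in> F" "c2 \<in> F" "c3 \<in> F" "c4 \<in> F" "c5 \<in> F" "c6 \<in> F"
  shows "unirational F 4 {x \<in> affine_space 4. cubic_norm (- b) x = g (x 3)}" (is "unirational F 4 ?V")
proof -
  interpret complex_subfield F by fact
  obtain \<beta> \<omega> where "cube_roots (- b) \<beta> \<omega>" using cube_roots_exist[of "- b"] b by auto
  then interpret cube_roots "- b" \<beta> \<omega> .
  have pe: "p \<in> F" "e \<in> F" "- b \<in> F"
    unfolding p_def e_def by (intro mem_intros mem)+
  have v: "(\<lambda>x. x 0) \<in> polyfuns F 4" by (rule polyfun_var) simp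
  have s: "(\<lambda>x. poly s (x 0)) \<in> polyfuns F 4"
    unfolding poly_s by (intro polyfun_add polyfun_mult polyfun_power polyfun_const mem v)
  have h: "(\<lambda>x. poly h (x 0)) \<in> polyfuns F 4"
    unfolding poly_h by (intro polyfun_diff polyfun_mult polyfun_power v polyfun_const mem_intros mem)
  have A: "(\<lambda>x. poly A (x 0)) \<in> polyfuns F 4"
    unfolding poly_A by (intro polyfun_add polyfun_diff polyfun_mult polyfun_power v s h polyfun_const mem_intros mem pe)
  have E: "(\<lambda>x. poly E (x 0)) \<in> polyfuns F 4"
    unfolding poly_E by (intro polyfun_mult polyfun_power v h A)
  have T: "(\<lambda>x. poly T (x 0)) \<in> polyfuns F 4"
    unfolding poly_T
    by (intro polyfun_uminus polyfun_add polyfun_diff polyfun_mult polyfun_power v s h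
        polyfun_const mem_intros mem pe)
  have base: "(\<lambda>x. base (x 0) i) \<in> polyfuns F 4" for i
  proof -
    \<comment> \<open>Polynomial functions allow no division, so the constant divisor becomes a
      coefficient in \<open>F\<close>.\<close>
    have c: "1 / (3 * b * d) \<in> F" by (intro mem_intros mem)
    have "(\<lambda>x. poly s (x 0) * poly h (x 0) * poly A (x 0) * x 0 ^ 2 * (1 / (3 * b * d)) * poly E (x 0))
        \<in> polyfuns F 4"
      by (intro polyfun_mult polyfun_power v s h A E polyfun_const c)
    then have last: "(\<lambda>x. poly s (x 0) * poly h (x 0) * poly A (x 0) * x 0 ^ 2 / (3 * b * d) * poly E (x 0))
        \<in> polyfuns F 4"
      by simp
    show ?thesis
    proof (cases "i = 0 \<or> i = 1")
      case True
      then show ?thesis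
        by (auto simp: base_def intro!: polyfun_add polyfun_mult polyfun_power v A E T polyfun_const mem pe)
    qed (use last in \<open>simp add: base_def\<close>)
  qed
  have z: "(\<lambda>x. x (Suc i)) \<in> polyfuns F 4" if "i < 3" for i
    using that by (intro polyfun_var) simp
  have n: "(\<lambda>x. cubic_norm (- b) (\<lambda>i. x (Suc i))) \<in> polyfuns F 4"
    by (intro polyfun_cubic_norm pe z)
  have D: "param_den \<in> polyfuns F 4"
    unfolding param_den_def by (intro polyfun_mult polyfun_power E n)
  have N: "param_num i \<in> polyfuns F 4" for i
  proof (cases "i < 3")
    case True
    then have "param_num i = (\<lambda>x. cubic_mult (- b) (base (x 0)) (cubic_mult (- b) (\<lambda>i. x (Suc i))
        (cubic_mult (- b) (\<lambda>i. x (Suc i)) (\<lambda>i. x (Suc i)))) i)"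
      by (simp add: fun_eq_iff param_num_def)
    then show ?thesis by (simp only:) (intro polyfun_cubic_mult pe base z)
  next
    case False
    then have "param_num i = (\<lambda>x. poly T (x 0) * poly E (x 0) * cubic_norm (- b) (\<lambda>i. x (Suc i)))"
      by (simp add: fun_eq_iff param_num_def)
    then show ?thesis by (simp only:) (intro polyfun_mult T E n)
  qed
  obtain S where S: "finite S" "\<And>t y. t \<notin> S \<Longrightarrow> cubic_norm (- b) y = g t \<Longrightarrow>
    \<exists>x\<in>affine_space 4. param_den x \<noteq> 0 \<and> (\<lambda>i\<in>{..<4}. param_num i x / param_den x) = coords4 y t"
    using param_surj by blast
  have "infinite (- S)"
    using S(1) infinite_UNIV_char_0 by (auto simp: finite_compl)
  then obtain t0 where "t0 \<notin> S" by (metis ComplD Compl_empty_eq finite.emptyI ex_in_conv)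
  \<comment> \<open>A point over \<open>t0\<close>; any preimage of it witnesses that the
    denominator is not identically zero.\<close>
  moreover have "cubic_norm (- b) (inv_eval 1 1 (g t0)) = g t0" by (simp add: norm_inv_eval)
  ultimately obtain x0 where x0: "param_den x0 \<noteq> 0" using S(2) by blast
  let ?im = "(\<lambda>y. \<lambda>i\<in>{..<4}. param_num i y / param_den y) ` {y \<in> affine_space 4. param_den y \<noteq> 0}"
  show ?thesis
  proof (rule unirationalI[OF N D x0])
    fix x assume x: "param_den x \<noteq> 0"
    have "cubic_norm (- b) (\<lambda>i\<in>{..<4}. param_num i x / param_den x)
        = cubic_norm (- b) (\<lambda>i. param_num i x / param_den x)"
      by (rule cubic_norm_cong) simp
    then show "(\<lambda>i\<in>{..<4}. param_num i x / param_den x) \<in> ?V"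
      using norm_param[OF x] param_t[OF x] by (simp add: affine_space_def)
  next
    show "?V \<subseteq> zariski_closure 4 ?im"
    proof
      fix x assume "x \<in> ?V"
      then have x: "x \<in> affine_space 4" "cubic_norm (- b) x = g (x 3)" by auto
      have "mpoly_eval P x = 0" if P: "\<forall>y\<in>?im. mpoly_eval P y = 0" for P
      proof -
        have "mpoly_eval P (coords4 x (x 3)) = 0"
        \<comment> \<open>The image contains every point over \<open>t \<notin> S\<close>, and
          continuity covers the finitely many remaining fibres.\<close>
        proof (rule vanishing_extends[OF _ S(1) isCont_g x(2)])
          fix y t assume "t \<notin> S" "cubic_norm (- b) y = g t"
          then obtain w where "w \<in> affine_space 4" "param_den w \<noteq> 0"
            "(\<lambda>i\<in>{..<4}. param_num i w / param_den w) = coords4 y t" using S(2) by blast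
          then have "coords4 y t \<in> ?im" by (metis (mono_tags, lifting) image_eqI mem_Collect_eq)
          then show "mpoly_eval P (coords4 y t) = 0" using P by blast
        qed
        then show ?thesis using coords4_eq[OF x(1)] by simp
      qed
      then show "x \<in> zariski_closure 4 ?im" using x(1) by (simp add: zariski_closure_def)
    qed
  qed simp
qed

end

subsection \<open>The approximating sextic\<close>

lemma (in complex_subfield) Rats_mem:
  assumes "x \<in> \<rat>"
  shows "complex_of_real x \<in> F"
proof -
  obtain i j where x: "x = of_int i / of_int j" using assms by (rule Rats_cases')
  have "of_int n \<in> F" for n :: int
    by (cases n rule: int_cases2) (auto intro: of_nat_mem uminus_mem)
  then show ?thesis unfolding x by (simp add: divide_mem)
qed

text \<open>If \<open>a\<close> itself is the forbidden value, a small positive rational shift stays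
  inside the field.\<close>

lemma (in complex_subfield) approx_avoiding:
  assumes "\<epsilon> > 0" "complex_of_real a \<in> F"
  shows "\<exists>c. complex_of_real c \<in> F \<and> \<bar>a - c\<bar> < \<epsilon> \<and> c \<noteq> z"
proof (cases "a = z")
  case True
  obtain q where q: "q \<in> \<rat>" "0 < q" "q < \<epsilon>" using Rats_dense_in_real[OF \<open>\<epsilon> > 0\<close>] by blast
  then have "complex_of_real (a + q) \<in> F" using assms(2) Rats_mem by (simp add: add_mem)
  then show ?thesis using q True by (intro exI[of _ "a + q"]) auto
next
  case False
  then show ?thesis using assms by (intro exI[of _ a]) auto
qed

lemma approx_rational_cube:
  fixes a \<epsilon> :: real
  assumes "a \<noteq> 0" "\<epsilon> > 0"
  shows "\<exists>d\<in>\<rat>. d \<noteq> 0 \<and> \<bar>a - d ^ 3\<bar> < \<epsilon>"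
proof -
  define r where "r = root 3 a"
  have r: "r ^ 3 = a" unfolding r_def by (simp add: odd_real_root_pow)
  have "isCont (\<lambda>x::real. x ^ 3) r" by (intro continuous_intros)
  \<comment> \<open>The bound by \<open>\<bar>a\<bar>\<close> keeps \<open>d ^ 3\<close>, and hence
    \<open>d\<close>, away from 0.\<close>
  moreover have "min \<epsilon> \<bar>a\<bar> > 0" using assms by simp
  ultimately obtain \<delta> where \<delta>: "\<delta> > 0"
      "\<And>x. x \<noteq> r \<Longrightarrow> \<bar>x - r\<bar> < \<delta> \<Longrightarrow> \<bar>x ^ 3 - r ^ 3\<bar> < min \<epsilon> \<bar>a\<bar>"
    unfolding isCont_def LIM_eq real_norm_def by meson
  obtain d where d: "d \<in> \<rat>" "r < d" "d < r + \<delta>" using Rats_dense_in_real[of r "r + \<delta>"] \<delta>(1) by auto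
  then have "\<bar>d ^ 3 - a\<bar> < min \<epsilon> \<bar>a\<bar>" using \<delta>(2)[of d] r by auto
  then have "\<bar>a - d ^ 3\<bar> < \<epsilon>" "d \<noteq> 0" by auto
  then show ?thesis using d(1) by blast
qed

lemma poly_of_real_sextic:
  "poly (map_poly complex_of_real
      (Polynomial.monom (c 0) 6 + (\<Sum>i=0..4. Polynomial.monom (c (6 - i)) i))) t
    = c 0 * t ^ 6 + c 2 * t ^ 4 + c 3 * t ^ 3 + c 4 * t ^ 2 + c 5 * t + c 6"
proof -
  have "Polynomial.monom (c 0) 6 + (\<Sum>i=0..4. Polynomial.monom (c (6 - i)) i)
      = [:c 6, c 5, c 4, c 3, c 2, 0, c 0:]"
    by (simp add: eval_nat_numeral monom_Suc monom_0)
  then show ?thesis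
    by (simp add: map_poly_pCons algebra_simps eval_nat_numeral)
qed

theorem theorem2p6:
  fixes k :: "real set" and a :: "nat \<Rightarrow> real" and f :: "real poly"
  assumes "real_number_field k"
    and "\<forall>i\<in>{0,2,3,4,5,6}. a i \<in> k"
    and "f = Polynomial.monom (a 0) 6 + (\<Sum>i=0..4. Polynomial.monom (a (6 - i)) i)"
    and "a 0 \<noteq> 0"
  shows "\<forall>\<epsilon>::real. \<epsilon> > 0 \<longrightarrow>
    (\<exists>(c :: nat \<Rightarrow> real) (g :: real poly).
       (\<forall>i\<in>{0,2,3,4,5,6}. c i \<in> k) \<and>
       g = Polynomial.monom (c 0) 6 + (\<Sum>i=0..4. Polynomial.monom (c (6 - i)) i) \<and>
       (\<forall>i\<in>{0,2,3,4,5,6}. \<bar>a i - c i\<bar> < \<epsilon>) \<and>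
       (\<forall>K \<alpha> b. pure_cubic_extension k K \<alpha> b \<longrightarrow>
          unirational (complex_of_real ` k) 4 (norm_variety b g)))"
proof (intro allI impI)
  fix \<epsilon> :: real assume \<epsilon>: "\<epsilon> > 0"
  define F where "F = complex_of_real ` k"
  interpret complex_subfield F
    unfolding F_def using assms(1) by (rule complex_subfield_number_field)
  have k: "x \<in> k \<longleftrightarrow> complex_of_real x \<in> F" for x by (auto simp: F_def)
  have a: "complex_of_real (a i) \<in> F" if "i \<in> {0,2,3,4,5,6}" for i using assms(2) that k by blast
  obtain d where d: "d \<in> \<rat>" "d \<noteq> 0" "\<bar>a 0 - d ^ 3\<bar> < \<epsilon>"
    using approx_rational_cube[OF assms(4) \<epsilon>] by blast
  obtain c3 where c3: "complex_of_real c3 \<in> F" "\<bar>a 3 - c3\<bar> < \<epsilon>" "c3 \<noteq> 0"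
    using approx_avoiding[OF \<epsilon>, of "a 3" 0] a by blast
  \<comment> \<open>Chosen after \<open>c3\<close>, because the forbidden value, where the
    nondegeneracy condition of \<open>sextic\<close> fails, depends on it.\<close>
  obtain c5 where c5: "complex_of_real c5 \<in> F" "\<bar>a 5 - c5\<bar> < \<epsilon>" "c5 \<noteq> a 2 * c3 / (3 * d ^ 3)"
    using approx_avoiding[OF \<epsilon>, of "a 5" "a 2 * c3 / (3 * d ^ 3)"] a by blast
  define c where "c = a(0 := d ^ 3, 3 := c3, 5 := c5)"
  define g where "g = Polynomial.monom (c 0) 6 + (\<Sum>i=0..4. Polynomial.monom (c (6 - i)) i)"
  have poly_g: "poly (map_poly complex_of_real g) t
      = c 0 * t ^ 6 + c 2 * t ^ 4 + c 3 * t ^ 3 + c 4 * t ^ 2 + c 5 * t + c 6" for t :: complex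
    unfolding g_def by (rule poly_of_real_sextic)
  have dF: "complex_of_real d \<in> F" by (rule Rats_mem[OF d(1)])
  have "\<forall>i\<in>{0,2,3,4,5,6}. c i \<in> k"
    using a c3 c5 power_mem[OF dF, of 3] by (simp add: c_def k)
  moreover have "\<forall>i\<in>{0,2,3,4,5,6}. \<bar>a i - c i\<bar> < \<epsilon>"
    using c3 c5 d \<epsilon> by (simp add: c_def)
  \<comment> \<open>The conditions imposed on \<open>g\<close> do not involve \<open>b\<close>, so
    one \<open>g\<close> serves all pure cubic extensions.\<close>
  moreover have "unirational F 4 (norm_variety b g)" if ext: "pure_cubic_extension k K \<alpha> b" for K \<alpha> b
  proof -
    have b: "complex_of_real b \<in> F" using ext by (simp add: pure_cubic_extension_def k)
    have "b \<noteq> 0"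
    proof
      assume "b = 0"
      \<comment> \<open>Zero is a cube in \<open>k\<close>, whereas \<open>b\<close> is not.\<close>
      moreover have "(0::real) \<in> (\<lambda>x. x ^ 3) ` k" using zero_mem k[of 0] by (intro image_eqI[of _ _ 0]) auto
      ultimately show False using ext by (simp add: pure_cubic_extension_def)
    qed
    have "3 * d ^ 3 * c5 \<noteq> a 2 * c3" using c5(3) d(2) by (simp add: field_simps)
    then have "complex_of_real (3 * d ^ 3 * c5) \<noteq> complex_of_real (a 2 * c3)"
      unfolding of_real_eq_iff .
    then interpret S: sextic b d "a 2" c3 "a 4" c5 "a 6"
      by unfold_locales (use \<open>b \<noteq> 0\<close> d c3 in simp_all)
    have "norm_variety b g = {x \<in> affine_space 4. cubic_norm (- of_real b) x = S.g (x 3)}"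
      unfolding norm_variety_def poly_g
      by (simp add: cubic_norm_def c_def S.g_def)
    then show ?thesis
      using S.unirational_hypersurface[OF complex_subfield_axioms] a b c3 c5 dF by simp
  qed
  ultimately show "\<exists>(c :: nat \<Rightarrow> real) (g :: real poly).
       (\<forall>i\<in>{0,2,3,4,5,6}. c i \<in> k) \<and>
       g = Polynomial.monom (c 0) 6 + (\<Sum>i=0..4. Polynomial.monom (c (6 - i)) i) \<and>
       (\<forall>i\<in>{0,2,3,4,5,6}. \<bar>a i - c i\<bar> < \<epsilon>) \<and>
       (\<forall>K \<alpha> b. pure_cubic_extension k K \<alpha> b \<longrightarrow>
          unirational (complex_of_real ` k) 4 (norm_variety b g))"
    unfolding F_def[symmetric] using g_def by blast
qed

end
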